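(* For an integer $l \ge 1$ and $\operatorname{Re}(s)>1$, we have $A_l = f^{*l}$ and $B_l = g^{*l}$, and therefore $$\mathcal{A}_l(s) := 1+\sum_{n=2}^\infty A_l(n)\, n^{-s} = \prod_{n=2}^\infty (1-n^{-s})^{-l}, \qquad \mathcal{B}_l(s) := 1+\sum_{n=2}^\infty B_l(n)\, n^{-s} = \prod_{n=2}^\infty (1+n^{-s})^{l}.$$ Further, for $k,l \ge 1$ and $\operatorname{Re}(s),\operatorname{Re}(z)>1$, we have $$\mathcal{F}_l(s) := 1+\sum_{n=2}^\infty\sum_{k=1}^\infty f_{k,l}(n)\, n^{-s}z^k = \prod_{n=2}^\infty (1-z n^{-s})^{-l}, \qquad \mathcal{G}_l(s) := 1+\sum_{n=2}^\infty\sum_{k=1}^\infty g_{k,l}(n)\, n^{-s}z^k = \prod_{n=2}^\infty (1+z n^{-s})^{l}.$$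
   Context: Here $s$ and $z$ denote complex numbers. For an integer $l\ge 1$, an $l$-colored part is a pair $(d,c)$ with $d\ge 2$ an integer (its value) and $c\in\{1,\dots,l\}$ (its color). An unordered $l$-colored factorization of an integer $n\ge 2$ is a finite multiset of $l$-colored parts whose values (with multiplicity) have product $n$ (the one-part factorizations $(n,c)$ are included). It is called distinct if no pair $(d,c)$ occurs more than once (so parts of equal value but different color count as distinct). For $n\ge 2$: $A_l(n)$ is the number of unordered $l$-colored factorizations of $n$ (so at most $l$ colors are used); $B_l(n)$ is the number of distinct unordered $l$-colored factorizations of $n$; $f_{k,l}(n)$ (respectively $g_{k,l}(n)$) is the number of unordered (respectively distinct unordered) $l$-colored factorizations of $n$ with exactly $k$ parts. Set $f:=A_1$, $g:=B_1$ and $A_l(1)=B_l(1)=1$ for all $l\ge 1$ (so $f(1)=g(1)=1$). For an arithmetic function $\phi$, $\phi^{*l}$ denotes its $l$-fold Dirichlet convolution with itself: $\phi^{*1}=\phi$ and $\phi^{*l}=\phi^{*(l-1)}*\phi$ for $l\ge 2$, where $(\phi*\psi)(n)=\sum_{n_1n_2=n}\phi(n_1)\psi(n_2)$.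
   Formalization: The identity for F_l is stated under the extra condition |z| < 2^{Re(s)}: outside it the series diverges (e.g. s=2, z=100), and at s=2, z=4 the factor n=2 is undefined. All other claims are as printed. *)

theory Defs
  imports "HOL-Analysis.Analysis" "HOL-Library.Multiset"
begin

text \<open>
  A coloured part is a pair (value, colour). For \<open>n = 1\<close> the only multiset that qualifies is the
  empty one, so the counting functions below satisfy the convention \<open>A\<^sub>l(1) = B\<^sub>l(1) = 1\<close>.
\<close>

definition factorizations :: "nat \<Rightarrow> nat \<Rightarrow> (nat \<times> nat) multiset set" where
  "factorizations l n =
     {M. (\<forall>(d, c) \<in> set_mset M. 2 \<le> d \<and> 1 \<le> c \<and> c \<le> l) \<and> prod_mset (image_mset fst M) = n}"

definition distinct_factorizations :: "nat \<Rightarrow> nat \<Rightarrow> (nat \<times> nat) multiset set" where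
  "distinct_factorizations l n = {M \<in> factorizations l n. \<forall>p. count M p \<le> 1}"

definition A :: "nat \<Rightarrow> nat \<Rightarrow> nat" where
  "A l n = card (factorizations l n)"

definition B :: "nat \<Rightarrow> nat \<Rightarrow> nat" where
  "B l n = card (distinct_factorizations l n)"

definition f_parts :: "nat \<Rightarrow> nat \<Rightarrow> nat \<Rightarrow> nat" where
  "f_parts k l n = card {M \<in> factorizations l n. size M = k}"

definition g_parts :: "nat \<Rightarrow> nat \<Rightarrow> nat \<Rightarrow> nat" where
  "g_parts k l n = card {M \<in> distinct_factorizations l n. size M = k}"

lemma factorizations_1: "factorizations l 1 = {{#}}"
proof -
  have "M = {#}" if "M \<in> factorizations l 1" for M
  proof (cases M)
    case (add p N)
    then have "2 \<le> fst p" "fst p dvd 1"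
      using that by (auto simp: factorizations_def)
    then show ?thesis by simp
  qed
  then show ?thesis by (auto simp: factorizations_def)
qed

lemma A_1: "A l 1 = 1"
  by (simp only: A_def factorizations_1) simp

lemma B_1: "B l 1 = 1"
proof -
  have "distinct_factorizations l 1 = {{#}}"
    unfolding distinct_factorizations_def factorizations_1 by auto
  then show ?thesis by (simp add: B_def)
qed

text \<open>Arithmetic functions live on the positive integers; the values at \<open>0\<close> are irrelevant.\<close>

definition dirichlet_conv :: "(nat \<Rightarrow> 'a::comm_semiring_1) \<Rightarrow> (nat \<Rightarrow> 'a) \<Rightarrow> nat \<Rightarrow> 'a" where
  "dirichlet_conv \<phi> \<psi> n = (\<Sum>(n1, n2) \<in> {(n1, n2). n1 * n2 = n}. \<phi> n1 * \<psi> n2)"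

fun conv_power :: "(nat \<Rightarrow> 'a::comm_semiring_1) \<Rightarrow> nat \<Rightarrow> nat \<Rightarrow> 'a" where
  "conv_power \<phi> 0 = (\<lambda>n. if n = 1 then 1 else 0)"
| "conv_power \<phi> (Suc 0) = \<phi>"
| "conv_power \<phi> (Suc (Suc l)) = dirichlet_conv (conv_power \<phi> (Suc l)) \<phi>"

text \<open>
  Series and products over \<open>n \<ge> 2\<close> and \<open>k \<ge> 1\<close> are indexed from \<open>0\<close> by shifting.
\<close>

definition A_term :: "nat \<Rightarrow> complex \<Rightarrow> nat \<Rightarrow> complex" where
  "A_term l s n = of_nat (A l n) * of_nat n powr (- s)"

definition B_term :: "nat \<Rightarrow> complex \<Rightarrow> nat \<Rightarrow> complex" where
  "B_term l s n = of_nat (B l n) * of_nat n powr (- s)"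

definition F_term :: "nat \<Rightarrow> complex \<Rightarrow> complex \<Rightarrow> nat \<Rightarrow> nat \<Rightarrow> complex" where
  "F_term l s z n k = of_nat (f_parts k l n) * of_nat n powr (- s) * z ^ k"

definition G_term :: "nat \<Rightarrow> complex \<Rightarrow> complex \<Rightarrow> nat \<Rightarrow> nat \<Rightarrow> complex" where
  "G_term l s z n k = of_nat (g_parts k l n) * of_nat n powr (- s) * z ^ k"

definition A_series :: "nat \<Rightarrow> complex \<Rightarrow> complex" where
  "A_series l s = 1 + (\<Sum>n. A_term l s (n + 2))"

definition B_series :: "nat \<Rightarrow> complex \<Rightarrow> complex" where
  "B_series l s = 1 + (\<Sum>n. B_term l s (n + 2))"

text \<open>
  For \<open>Re s > 1\<close> and \<open>\<bar>z\<bar> > 1\<close> the series \<open>F_series l s z\<close> converges only if \<open>\<bar>z\<bar> < 2 powr Re s\<close>: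
  the generating function of the coefficients at \<open>n = 2^m\<close> is the product of the
  \<open>(1 - z * x^j)\<close> to the power \<open>-l\<close>, whose dominant pole \<open>x = 1/z\<close> makes the terms at
  \<open>n = 2^m\<close> grow like \<open>m^(l-1) * (\<bar>z\<bar> / 2 powr Re s)^m\<close>.
  The series \<open>G_series l s z\<close> converges for every \<open>z\<close>.
\<close>

definition F_series :: "nat \<Rightarrow> complex \<Rightarrow> complex \<Rightarrow> complex" where
  "F_series l s z = 1 + (\<Sum>n. \<Sum>k. F_term l s z (n + 2) (k + 1))"

definition G_series :: "nat \<Rightarrow> complex \<Rightarrow> complex \<Rightarrow> complex" where
  "G_series l s z = 1 + (\<Sum>n. \<Sum>k. G_term l s z (n + 2) (k + 1))"

end

theory Submission
  imports Defs
begin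

text \<open>
  Colours are independent. A factorization with \<open>l + m\<close> colours is a pair consisting of one with
  \<open>l\<close> colours and one with \<open>m\<close> colours, and the products of the two multiply
  (\<open>bij_betw_merge_colors\<close>). Counting gives a Dirichlet convolution, and induction on the number of
  colours gives the convolution powers.

  The generating functions come from one Euler product. A part \<open>(d, c)\<close> receives the weight
  \<open>z * d powr (- s)\<close>, and a multiset of parts the product of the weights of its members; for a
  factorization of \<open>n\<close> into \<open>k\<close> parts this is \<open>z ^ k * n powr (- s)\<close>. A multiset is a choice of
  a multiplicity for every part, so the sum of the weights of all permitted multisets is the product over the parts
  of \<open>\<Sum>k\<in>K. x ^ k\<close>, where \<open>x\<close> is the weight of the part and \<open>K\<close> the set of permitted multiplicities
  (\<open>multisets_over_euler_product\<close>). For \<open>K = UNIV\<close> this factor is \<open>1 / (1 - x)\<close>, for \<open>K = {0, 1}\<close> it is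
  \<open>1 + x\<close>. Each value \<open>d\<close> occurs in \<open>l\<close> colours, hence the exponent \<open>l\<close>. Grouping the multisets
  by their product \<open>n\<close> turns the same sum into a Dirichlet series (\<open>dirichlet_euler_product\<close>).

  All rearrangements are licensed by absolute convergence, which is itself read off from the finite products:
  these are bounded by \<open>exp\<close> of a multiple of \<open>\<Sum> d powr (- Re s)\<close>
  (\<open>multisets_over_abs_summable\<close>). The counts of factorizations without regard to the number of parts
  are the case \<open>z = 1\<close>.
\<close>

section \<open>Euler products over multisets\<close>

text \<open>
  The set \<open>K\<close> lists the permitted multiplicities: \<open>UNIV\<close> gives all multisets over \<open>P\<close>,
  and \<open>{0, 1}\<close> the ones without repetition.
\<close>

definition multisets_over :: "nat set \<Rightarrow> 'a set \<Rightarrow> 'a multiset set" where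
  "multisets_over K P = {M. set_mset M \<subseteq> P \<and> (\<forall>p. count M p \<in> K)}"

lemma multisets_over_mono: "P \<subseteq> Q \<Longrightarrow> multisets_over K P \<subseteq> multisets_over K Q"
  by (auto simp: multisets_over_def)

lemma prod_mset_eq_prod_count:
  fixes x :: "'a \<Rightarrow> 'b::comm_monoid_mult"
  assumes "finite P" "set_mset M \<subseteq> P"
  shows "(\<Prod>p\<in>#M. x p) = (\<Prod>p\<in>P. x p ^ count M p)"
  unfolding image_prod_mset_multiplicity
  by (rule prod.mono_neutral_left) (use assms in \<open>auto simp: not_in_iff\<close>)

text \<open>
  A multiset over a finite set is the choice of one multiplicity for each element. Through this
  bijection a sum over multisets becomes a sum over a product set, which factors.
\<close>

lemma bij_betw_count_multisets_over:
  assumes "finite P" "0 \<in> K"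
  shows "bij_betw (\<lambda>M. restrict (count M) P) (multisets_over K P) (PiE P (\<lambda>_. K))"
proof (rule bij_betw_byWitness)
  let ?g = "\<lambda>h. Abs_multiset (\<lambda>p. if p \<in> P then h p else 0)"
  have count_g: "count (?g h) = (\<lambda>p. if p \<in> P then h p else 0)" for h
    by (rule Abs_multiset_inverse) (use assms(1) in auto)
  show "\<forall>M\<in>multisets_over K P. ?g (restrict (count M) P) = M"
  proof
    fix M assume "M \<in> multisets_over K P"
    then have "set_mset M \<subseteq> P"
      by (simp add: multisets_over_def)
    then show "?g (restrict (count M) P) = M"
      by (intro multiset_eqI) (auto simp: count_g not_in_iff subset_iff)
  qed
  show "\<forall>h\<in>PiE P (\<lambda>_. K). restrict (count (?g h)) P = h"
    by (auto simp: count_g fun_eq_iff PiE_def extensional_def)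
  show "(\<lambda>M. restrict (count M) P) ` multisets_over K P \<subseteq> PiE P (\<lambda>_. K)"
    by (auto simp: multisets_over_def)
  show "?g ` PiE P (\<lambda>_. K) \<subseteq> multisets_over K P"
  proof safe
    fix h assume h: "h \<in> PiE P (\<lambda>_. K)"
    have "set_mset (?g h) \<subseteq> P"
      by (auto simp: set_mset_def count_g split: if_splits)
    then show "?g h \<in> multisets_over K P"
      using h assms(2) by (auto simp: multisets_over_def count_g)
  qed
qed

text \<open>
  Finitely many multisets involve only finitely many elements and multiplicities. Their total
  weight is therefore at most a finite product of finite sums, each of them at most
  \<open>1 + b p\<close>, and \<open>\<Prod>(1 + b p) \<le> exp (\<Sum> b p)\<close> bounds all these products by one constant.
\<close>

lemma multisets_over_abs_summable:
  fixes x :: "'a \<Rightarrow> 'b::real_normed_field"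
  assumes K: "0 \<in> K"
    and b: "b summable_on P" "\<And>p. p \<in> P \<Longrightarrow> 0 \<le> b p"
    and x: "\<And>p. p \<in> P \<Longrightarrow> (\<lambda>k. norm (x p ^ k)) summable_on K"
      "\<And>p. p \<in> P \<Longrightarrow> (\<Sum>\<^sub>\<infinity>k\<in>K. norm (x p ^ k)) \<le> 1 + b p"
  shows "(\<lambda>M. norm (\<Prod>p\<in>#M. x p)) summable_on multisets_over K P"
proof -
  have bound: "(\<Sum>M\<in>X. norm (\<Prod>p\<in>#M. x p)) \<le> exp (infsum b P)"
    if X: "X \<subseteq> multisets_over K P" "finite X" for X
  proof -
    define F where "F = (\<Union>M\<in>X. set_mset M)"
    \<comment> \<open>Allowing the multiplicity 0 lets every element of F be absent from a multiset of X.\<close>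
    define J where "J = insert 0 ((\<lambda>(M, p). count M p) ` (X \<times> F))"
    have F: "finite F" "F \<subseteq> P"
      using X by (auto simp: F_def multisets_over_def)
    have J: "finite J" "J \<subseteq> K" "0 \<in> J"
      using X F K by (auto simp: J_def multisets_over_def)
    have "X \<subseteq> multisets_over J F"
    proof
      fix M assume M: "M \<in> X"
      have "count M p \<in> J" for p
      proof (cases "p \<in> F")
        case True
        then show ?thesis using M by (force simp: J_def)
      next
        case False
        then show ?thesis using M J(3) by (auto simp: F_def not_in_iff)
      qed
      then show "M \<in> multisets_over J F"
        using M by (auto simp: multisets_over_def F_def)
    qed
    moreover have bij: "bij_betw (\<lambda>M. restrict (count M) F) (multisets_over J F) (PiE F (\<lambda>_. J))"
      by (rule bij_betw_count_multisets_over) (use F J in auto)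
    moreover have "finite (PiE F (\<lambda>_. J))"
      using F J by (intro finite_PiE) auto
    ultimately have "(\<Sum>M\<in>X. norm (\<Prod>p\<in>#M. x p)) \<le> (\<Sum>M\<in>multisets_over J F. norm (\<Prod>p\<in>#M. x p))"
      by (intro sum_mono2) (auto simp: bij_betw_finite)
    also have "\<dots> = (\<Sum>M\<in>multisets_over J F. \<Prod>p\<in>F. norm (x p ^ restrict (count M) F p))"
    proof (rule sum.cong)
      fix M assume "M \<in> multisets_over J F"
      then show "norm (\<Prod>p\<in>#M. x p) = (\<Prod>p\<in>F. norm (x p ^ restrict (count M) F p))"
        using F(1) by (subst prod_mset_eq_prod_count[of F]) (auto simp: multisets_over_def prod_norm)
    qed simp
    also have "\<dots> = (\<Sum>h\<in>PiE F (\<lambda>_. J). \<Prod>p\<in>F. norm (x p ^ h p))"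
      by (rule sum.reindex_bij_betw[OF bij])
    also have "\<dots> = (\<Prod>p\<in>F. \<Sum>k\<in>J. norm (x p ^ k))"
      by (rule prod_sum_PiE[symmetric]) (use F J in auto)
    also have "\<dots> \<le> (\<Prod>p\<in>F. 1 + b p)"
    proof (rule prod_mono)
      fix p assume p: "p \<in> F"
      have "(\<Sum>k\<in>J. norm (x p ^ k)) \<le> (\<Sum>\<^sub>\<infinity>k\<in>K. norm (x p ^ k))"
        by (rule finite_sum_le_infsum) (use p F J x(1) in auto)
      also have "\<dots> \<le> 1 + b p"
        using p F x(2) by auto
      finally show "0 \<le> (\<Sum>k\<in>J. norm (x p ^ k)) \<and> (\<Sum>k\<in>J. norm (x p ^ k)) \<le> 1 + b p"
        by (simp add: sum_nonneg)
    qed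
    also have "\<dots> \<le> exp (sum b F)"
      by (rule prod_le_exp_sum) (use F b in auto)
    also have "sum b F \<le> infsum b P"
      by (rule finite_sum_le_infsum) (use F b in auto)
    finally show ?thesis by simp
  qed
  show ?thesis
    unfolding abs_summable_iff_bdd_above
    by (rule bdd_aboveI2[where M = "exp (infsum b P)"]) (use bound in auto)
qed

lemma infsum_multisets_over_finite:
  fixes x :: "'a \<Rightarrow> 'b::{real_normed_field,banach}"
  assumes "finite P" "0 \<in> K" "\<And>p. p \<in> P \<Longrightarrow> (\<lambda>k. norm (x p ^ k)) summable_on K"
  shows "(\<Sum>\<^sub>\<infinity>M\<in>multisets_over K P. \<Prod>p\<in>#M. x p) = (\<Prod>p\<in>P. \<Sum>\<^sub>\<infinity>k\<in>K. x p ^ k)"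
proof -
  have "(\<Sum>\<^sub>\<infinity>M\<in>multisets_over K P. \<Prod>p\<in>#M. x p)
      = (\<Sum>\<^sub>\<infinity>M\<in>multisets_over K P. \<Prod>p\<in>P. x p ^ restrict (count M) P p)"
    by (rule infsum_cong)
      (use assms(1) in \<open>auto simp: multisets_over_def prod_mset_eq_prod_count[of P]\<close>)
  also have "\<dots> = (\<Sum>\<^sub>\<infinity>h\<in>PiE P (\<lambda>_. K). \<Prod>p\<in>P. x p ^ h p)"
    by (rule infsum_reindex_bij_betw[OF bij_betw_count_multisets_over[OF assms(1,2)]])
  also have "\<dots> = (\<Prod>p\<in>P. \<Sum>\<^sub>\<infinity>k\<in>K. x p ^ k)"
    by (rule infsum_prod_PiE_abs) (use assms in auto)
  finally show ?thesis .
qed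

text \<open>
  A finite set of multisets that carries almost all of the absolute weight uses only finitely many
  elements of \<open>P\<close>. As soon as \<open>F\<close> contains these, only a small weight is missed.
\<close>

lemma infsum_multisets_over_tendsto:
  fixes w :: "'a multiset \<Rightarrow> 'b::banach"
  assumes w: "(\<lambda>M. norm (w M)) summable_on multisets_over K P"
  shows "((\<lambda>F. infsum w (multisets_over K F)) \<longlongrightarrow> infsum w (multisets_over K P))
    (finite_subsets_at_top P)"
proof (rule tendstoI)
  fix e :: real assume "e > 0"
  let ?M = "multisets_over K"
  obtain X where X: "finite X" "X \<subseteq> ?M P"
    and approx: "dist (\<Sum>M\<in>X. norm (w M)) (\<Sum>\<^sub>\<infinity>M\<in>?M P. norm (w M)) \<le> e / 2"
    using infsum_finite_approximation[OF w, of "e / 2"] \<open>e > 0\<close> by auto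
  have close: "dist (infsum w (?M F)) (infsum w (?M P)) < e"
    if F: "F \<subseteq> P" "(\<Union>M\<in>X. set_mset M) \<subseteq> F" for F
  proof -
    have sub: "?M F \<subseteq> ?M P" "X \<subseteq> ?M F"
      using multisets_over_mono[OF F(1)] F(2) X by (auto simp: multisets_over_def)
    have sumF: "(\<lambda>M. norm (w M)) summable_on ?M F" "(\<lambda>M. norm (w M)) summable_on (?M P - ?M F)"
      "(\<lambda>M. norm (w M)) summable_on (?M P - X)"
      by (rule summable_on_subset_banach[OF w], use sub in auto)+
    have "infsum w (?M P - ?M F) = infsum w (?M P) - infsum w (?M F)"
      by (rule infsum_Diff[OF abs_summable_summable[OF w] abs_summable_summable[OF sumF(1)] sub(1)])
    then have "dist (infsum w (?M F)) (infsum w (?M P)) = norm (infsum w (?M P - ?M F))"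
      by (simp add: dist_norm norm_minus_commute)
    also have "\<dots> \<le> (\<Sum>\<^sub>\<infinity>M\<in>?M P - ?M F. norm (w M))"
      by (rule norm_infsum_bound) fact
    also have "\<dots> \<le> (\<Sum>\<^sub>\<infinity>M\<in>?M P - X. norm (w M))"
      by (rule infsum_mono2) (use sumF sub in auto)
    also have "\<dots> = (\<Sum>\<^sub>\<infinity>M\<in>?M P. norm (w M)) - (\<Sum>M\<in>X. norm (w M))"
      by (subst infsum_Diff[OF w summable_on_finite]) (use X in auto)
    also have "\<dots> \<le> e / 2"
      using approx unfolding dist_real_def by linarith
    finally show ?thesis using \<open>e > 0\<close> by simp
  qed
  have "finite (\<Union>M\<in>X. set_mset M)" "(\<Union>M\<in>X. set_mset M) \<subseteq> P"
    using X by (auto simp: multisets_over_def)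
  then show "\<forall>\<^sub>F F in finite_subsets_at_top P. dist (infsum w (?M F)) (infsum w (?M P)) < e"
    unfolding eventually_finite_subsets_at_top
    by (intro exI[of _ "\<Union>M\<in>X. set_mset M"] conjI allI impI close) auto
qed

text \<open>
  The Euler product in general form: the exact factorization over finite subsets \<open>F\<close>, passed to the
  limit along the filter of finite subsets of \<open>P\<close>. This form keeps the order in which the
  factors are taken open.
\<close>

theorem multisets_over_euler_product:
  fixes x :: "'a \<Rightarrow> 'b::{real_normed_field,banach}"
  assumes K: "0 \<in> K"
    and b: "b summable_on P" "\<And>p. p \<in> P \<Longrightarrow> 0 \<le> b p"
    and x: "\<And>p. p \<in> P \<Longrightarrow> (\<lambda>k. norm (x p ^ k)) summable_on K"
      "\<And>p. p \<in> P \<Longrightarrow> (\<Sum>\<^sub>\<infinity>k\<in>K. norm (x p ^ k)) \<le> 1 + b p"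
  shows "((\<lambda>F. \<Prod>p\<in>F. \<Sum>\<^sub>\<infinity>k\<in>K. x p ^ k) \<longlongrightarrow> (\<Sum>\<^sub>\<infinity>M\<in>multisets_over K P. \<Prod>p\<in>#M. x p))
    (finite_subsets_at_top P)"
proof (rule Lim_transform_eventually)
  show "((\<lambda>F. \<Sum>\<^sub>\<infinity>M\<in>multisets_over K F. \<Prod>p\<in>#M. x p) \<longlongrightarrow> (\<Sum>\<^sub>\<infinity>M\<in>multisets_over K P. \<Prod>p\<in>#M. x p))
    (finite_subsets_at_top P)"
    by (intro infsum_multisets_over_tendsto multisets_over_abs_summable[where b = b] assms)
  show "\<forall>\<^sub>F F in finite_subsets_at_top P.
      (\<Sum>\<^sub>\<infinity>M\<in>multisets_over K F. \<Prod>p\<in>#M. x p) = (\<Prod>p\<in>F. \<Sum>\<^sub>\<infinity>k\<in>K. x p ^ k)"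
    by (intro eventually_finite_subsets_at_top_weakI infsum_multisets_over_finite)
      (use K x(1) in auto)
qed

section \<open>Factorizations as multisets of coloured parts\<close>

definition colored_parts :: "nat \<Rightarrow> (nat \<times> nat) set" where
  "colored_parts l = {2..} \<times> {1..l}"

definition factorizations_over :: "nat set \<Rightarrow> nat \<Rightarrow> nat \<Rightarrow> (nat \<times> nat) multiset set" where
  "factorizations_over K l n = {M \<in> multisets_over K (colored_parts l). (\<Prod>p\<in>#M. fst p) = n}"

lemma factorizations_eq: "factorizations l n = factorizations_over UNIV l n"
  by (auto simp: factorizations_def factorizations_over_def multisets_over_def colored_parts_def)

lemma distinct_factorizations_eq: "distinct_factorizations l n = factorizations_over {0, 1} l n"
proof -
  have "m \<le> 1 \<longleftrightarrow> m \<in> {0, 1}" for m :: nat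
    by auto
  then show ?thesis
    unfolding distinct_factorizations_def factorizations_eq factorizations_over_def multisets_over_def
    by auto
qed

text \<open>
  Every part is at least 2, so each further part at least doubles the product. This bounds the number
  of parts of a factorization of \<open>n\<close>, which makes the factorizations of \<open>n\<close> finite in number
  and the sum over the number of parts a finite sum.
\<close>

lemma size_less_prod_parts:
  assumes "set_mset M \<subseteq> colored_parts l"
  shows "size M < (\<Prod>p\<in>#M. fst p)"
  using assms
proof (induction M)
  case (add p M)
  then have "size M < (\<Prod>p\<in>#M. fst p)" "2 \<le> fst p"
    by (auto simp: colored_parts_def)
  then have "size M + 1 < 2 * (\<Prod>p\<in>#M. fst p)" "2 * (\<Prod>p\<in>#M. fst p) \<le> fst p * (\<Prod>p\<in>#M. fst p)"
    by (linarith, intro mult_le_mono1)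
  then have "size M + 1 < fst p * (\<Prod>p\<in>#M. fst p)"
    by (rule less_le_trans)
  then show ?case by simp
qed auto

lemma size_factorization_less:
  "M \<in> factorizations_over K l n \<Longrightarrow> size M < n"
  using size_less_prod_parts[of M l] by (auto simp: factorizations_over_def multisets_over_def)

lemma finite_factorizations_over: "finite (factorizations_over K l n)"
proof (rule finite_subset)
  show "factorizations_over K l n \<subseteq> (\<Union>k<n. multisets_of_size ({2..n} \<times> {1..l}) k)"
  proof
    fix M assume M: "M \<in> factorizations_over K l n"
    have "p \<in> {2..n} \<times> {1..l}" if p: "p \<in># M" for p
    proof -
      have "p \<in> colored_parts l"
        using M p by (auto simp: factorizations_over_def multisets_over_def)
      moreover have "fst p dvd n"
        using M p by (auto simp: factorizations_over_def intro!: dvd_prod_mset)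
      then have "fst p \<le> n"
        using size_factorization_less[OF M] by (intro dvd_imp_le) auto
      ultimately show ?thesis
        by (auto simp: colored_parts_def)
    qed
    then show "M \<in> (\<Union>k<n. multisets_of_size ({2..n} \<times> {1..l}) k)"
      using size_factorization_less[OF M] by (auto simp: multisets_of_size_def)
  qed
  show "finite (\<Union>k<n. multisets_of_size ({2..n} \<times> {1..l}) k)"
    by (intro finite_UN_I finite_multisets_of_size) auto
qed

lemma factorizations_over_1:
  assumes "0 \<in> K"
  shows "factorizations_over K l 1 = {{#}}"
proof -
  have "M = {#}" if "M \<in> factorizations_over K l 1" for M
    using size_factorization_less[OF that] by simp
  then show ?thesis
    using assms by (auto simp: factorizations_over_def multisets_over_def)
qed

section \<open>Splitting the colours: Dirichlet convolution\<close>

definition recolor :: "nat \<Rightarrow> nat \<times> nat \<Rightarrow> nat \<times> nat" where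
  "recolor l = (\<lambda>(d, c). (d, c + l))"

lemma inj_recolor: "inj (recolor l)"
  by (auto simp: inj_def recolor_def)

lemma count_recolor: "count (image_mset (recolor l) M) (recolor l p) = count M p"
  by (induction M) (auto simp: inj_eq[OF inj_recolor])

text \<open>
  A factorization with \<open>l + m\<close> colours splits uniquely into its parts of colour at most \<open>l\<close> and
  the remaining parts, whose colours are lowered by \<open>l\<close>. The products \<open>n1\<close> and \<open>n2\<close> of the
  two pieces satisfy \<open>n1 * n2 = n\<close>. Multiplicities are not changed, so the same bijection serves the
  unrestricted and the distinct factorizations.
\<close>

lemma bij_betw_merge_colors:
  assumes "0 \<in> K"
  shows "bij_betw (\<lambda>((n1, n2), M1, M2). M1 + image_mset (recolor l) M2)
    (SIGMA (n1, n2):{(n1, n2). n1 * n2 = n}. factorizations_over K l n1 \<times> factorizations_over K m n2)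
    (factorizations_over K (l + m) n)"
    (is "bij_betw ?f ?S ?T")
  unfolding bij_betw_def
proof
  have split: "filter_mset (\<lambda>p. snd p \<le> l) (M1 + image_mset (recolor l) M2) = M1"
      "filter_mset (\<lambda>p. \<not> snd p \<le> l) (M1 + image_mset (recolor l) M2) = image_mset (recolor l) M2"
    if M: "M1 \<in> factorizations_over K l n1" "M2 \<in> factorizations_over K m n2" for M1 M2 n1 n2
  proof -
    have "\<forall>p. p \<in># M1 \<longrightarrow> snd p \<le> l" "\<forall>p. p \<in># image_mset (recolor l) M2 \<longrightarrow> \<not> snd p \<le> l"
      using M by (auto simp: factorizations_over_def multisets_over_def colored_parts_def recolor_def)
    then show "filter_mset (\<lambda>p. snd p \<le> l) (M1 + image_mset (recolor l) M2) = M1"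
      "filter_mset (\<lambda>p. \<not> snd p \<le> l) (M1 + image_mset (recolor l) M2) = image_mset (recolor l) M2"
      unfolding multiset_eq_iff count_filter_mset count_union
      by (metis add_0_right not_in_iff, metis add_0 not_in_iff)
  qed
  show "inj_on ?f ?S"
  proof (rule inj_onI)
    fix S T assume S: "S \<in> ?S" and T: "T \<in> ?S" and eq: "?f S = ?f T"
    obtain n1 n2 M1 M2 where S': "S = ((n1, n2), M1, M2)"
      by (metis prod.exhaust)
    obtain n1' n2' N1 N2 where T': "T = ((n1', n2'), N1, N2)"
      by (metis prod.exhaust)
    have M: "M1 \<in> factorizations_over K l n1" "M2 \<in> factorizations_over K m n2"
      and N: "N1 \<in> factorizations_over K l n1'" "N2 \<in> factorizations_over K m n2'"
      using S T by (auto simp: S' T')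
    have "M1 + image_mset (recolor l) M2 = N1 + image_mset (recolor l) N2"
      using eq by (simp add: S' T')
    then have "M1 = N1" "image_mset (recolor l) M2 = image_mset (recolor l) N2"
      using split[OF M] split[OF N] by simp_all
    moreover from this have "M2 = N2"
      using multiset.inj_map[OF inj_recolor[of l]] by (simp add: inj_eq)
    ultimately show "S = T"
      using M N by (auto simp: S' T' factorizations_over_def)
  qed
  show "?f ` ?S = ?T"
  proof (intro equalityI subsetI)
    fix M assume "M \<in> ?f ` ?S"
    then obtain n1 n2 M1 M2 where M: "M = M1 + image_mset (recolor l) M2" and n: "n1 * n2 = n"
      and M1: "M1 \<in> factorizations_over K l n1" and M2: "M2 \<in> factorizations_over K m n2"
      by auto
    have "count M p \<in> K" for p
    proof (cases "snd p \<le> l")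
      case True
      then have "count M p = count M1 p"
        using arg_cong[OF split(1)[OF M1 M2], of "\<lambda>X. count X p"] by (simp add: M)
      then show ?thesis using M1 by (simp add: factorizations_over_def multisets_over_def del: split_paired_All)
    next
      case False
      then have "p = recolor l (fst p, snd p - l)"
        by (simp add: recolor_def)
      moreover have "count M p = count (image_mset (recolor l) M2) p"
        using False arg_cong[OF split(2)[OF M1 M2], of "\<lambda>X. count X p"] by (simp add: M)
      ultimately have "count M p = count M2 (fst p, snd p - l)"
        by (metis count_recolor)
      then show ?thesis using M2 by (simp add: factorizations_over_def multisets_over_def del: split_paired_All)
    qed
    moreover have "(\<Prod>p\<in>#image_mset (recolor l) M2. fst p) = n2"
      using M2 by (simp add: multiset.map_comp recolor_def o_def case_prod_unfold factorizations_over_def)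
    ultimately show "M \<in> ?T"
      using M1 M2 n
      by (auto simp: M factorizations_over_def multisets_over_def colored_parts_def recolor_def)
  next
    fix M assume M: "M \<in> ?T"
    define M1 where "M1 = filter_mset (\<lambda>p. snd p \<le> l) M"
    define H where "H = filter_mset (\<lambda>p. \<not> snd p \<le> l) M"
    define M2 where "M2 = image_mset (\<lambda>(d, c). (d, c - l)) H"
    have H: "H = image_mset (recolor l) M2"
      unfolding M2_def multiset.map_comp
      by (rule multiset.map_ident_strong[symmetric]) (auto simp: H_def recolor_def)
    have M_eq: "M = M1 + image_mset (recolor l) M2"
      unfolding H[symmetric] M1_def H_def by (rule multiset_partition)
    have parts: "set_mset M \<subseteq> colored_parts (l + m)" and count_M: "\<And>p. count M p \<in> K"
      and prod_M: "(\<Prod>p\<in>#M. fst p) = n"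
      using M by (auto simp: factorizations_over_def multisets_over_def)
    have "count M1 p \<in> K" for p
      using count_M[of p] assms by (simp add: M1_def)
    moreover have "count M2 p \<in> K" for p
    proof -
      have "count M2 p = count H (recolor l p)"
        unfolding H by (rule count_recolor[symmetric])
      then show ?thesis
        using count_M[of "recolor l p"] assms by (simp add: H_def)
    qed
    moreover have "set_mset M1 \<subseteq> colored_parts l" "set_mset M2 \<subseteq> colored_parts m"
      using parts by (fastforce simp: M1_def M2_def H_def colored_parts_def)+
    ultimately have "M1 \<in> factorizations_over K l (\<Prod>p\<in>#M1. fst p)"
      "M2 \<in> factorizations_over K m (\<Prod>p\<in>#M2. fst p)"
      by (simp_all add: factorizations_over_def multisets_over_def)
    moreover have "(\<Prod>p\<in>#M1. fst p) * (\<Prod>p\<in>#M2. fst p) = n"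
      using prod_M unfolding M_eq
      by (simp add: multiset.map_comp recolor_def o_def case_prod_unfold)
    ultimately have "(((\<Prod>p\<in>#M1. fst p), (\<Prod>p\<in>#M2. fst p)), M1, M2) \<in> ?S"
      by simp
    then have "?f (((\<Prod>p\<in>#M1. fst p), (\<Prod>p\<in>#M2. fst p)), M1, M2) \<in> ?f ` ?S"
      by (rule imageI)
    then show "M \<in> ?f ` ?S"
      by (simp add: M_eq[symmetric])
  qed
qed

lemma finite_divisor_pairs:
  fixes n :: nat
  assumes "n \<ge> 1"
  shows "finite {(n1, n2). n1 * n2 = n}"
proof (rule finite_subset)
  show "{(n1, n2). n1 * n2 = n} \<subseteq> {..n} \<times> {..n}"
    using assms by auto
qed simp

lemma card_factorizations_over_add:
  assumes "0 \<in> K" "n \<ge> 1"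
  shows "card (factorizations_over K (l + m) n)
    = dirichlet_conv (\<lambda>n. card (factorizations_over K l n)) (\<lambda>n. card (factorizations_over K m n)) n"
  unfolding dirichlet_conv_def bij_betw_same_card[OF bij_betw_merge_colors[OF assms(1)], symmetric]
  by (subst card_SigmaI)
    (use finite_divisor_pairs[OF assms(2)] in
      \<open>auto simp: finite_factorizations_over card_cartesian_product case_prod_unfold intro!: sum.cong\<close>)

lemma card_factorizations_over_conv_power:
  assumes "0 \<in> K" "l \<ge> 1" "n \<ge> 1"
  shows "card (factorizations_over K l n) = conv_power (\<lambda>n. card (factorizations_over K 1 n)) l n"
  using assms(2,3)
proof (induction l arbitrary: n rule: dec_induct)
  case (step l)
  obtain j where l: "l = Suc j"
    using step.hyps by (cases l) auto
  have "card (factorizations_over K (l + 1) n)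
      = dirichlet_conv (\<lambda>n. card (factorizations_over K l n)) (\<lambda>n. card (factorizations_over K 1 n)) n"
    by (rule card_factorizations_over_add) (use assms(1) step.prems in auto)
  also have "\<dots> = dirichlet_conv (conv_power (\<lambda>n. card (factorizations_over K 1 n)) l)
      (\<lambda>n. card (factorizations_over K 1 n)) n"
    unfolding dirichlet_conv_def
  proof (rule sum.cong, goal_cases)
    case (2 p)
    \<comment> \<open>The induction hypothesis speaks only of positive arguments; a factor of n is positive.\<close>
    then have "fst p \<ge> 1"
      using step.prems by (cases "fst p") auto
    then show ?case
      by (simp add: step.IH case_prod_unfold)
  qed simp
  finally show ?case
    by (simp add: l)
qed simp

section \<open>Dirichlet series of the factorization counts\<close>

lemma norm_of_nat_powr: "norm (of_nat n powr (- s) :: complex) = of_nat n powr (- Re s)"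
  by (subst norm_powr_real_powr) auto

lemma summable_norm_of_nat_powr:
  assumes "Re s > 1"
  shows "summable (\<lambda>n. norm (of_nat n powr (- s) :: complex))"
  unfolding norm_of_nat_powr using assms by (simp add: summable_real_powr_iff)

text \<open>
  Giving each part \<open>(d, c)\<close> the weight \<open>z * d powr (- s)\<close> makes the weight of a factorization depend
  only on its number of parts and on the number that it factors.
\<close>

lemma prod_weight_parts:
  "(\<Prod>p\<in>#M. z * of_nat (fst p) powr (- s)) = z ^ size M * of_nat (\<Prod>p\<in>#M. fst p) powr (- s)"
  for z s :: complex
  by (induction M) (auto simp: powr_times_real)

definition size_enumerator :: "nat set \<Rightarrow> nat \<Rightarrow> complex \<Rightarrow> nat \<Rightarrow> complex" where
  "size_enumerator K l z n = (\<Sum>M\<in>factorizations_over K l n. z ^ size M)"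

text \<open>
  Sorting the factorizations of \<open>n\<close> by their number of parts. A number \<open>n \<ge> 2\<close> has no factorization
  without parts, so the sum may start at one part.
\<close>

lemma size_enumerator_sums:
  assumes "n \<ge> 2"
  shows "(\<lambda>k. of_nat (card {M \<in> factorizations_over K l n. size M = k + 1}) * z ^ (k + 1)) sums
    size_enumerator K l z n"
proof -
  let ?R = "factorizations_over K l n"
  let ?c = "\<lambda>k. of_nat (card {M \<in> ?R. size M = k}) * z ^ k"
  have none: "{M \<in> ?R. size M = k} = {}" if "k \<ge> n" for k
    using that size_factorization_less[of _ K l n] by (auto simp: not_less[symmetric])
  have "{M \<in> ?R. size M = 0} = {}"
    using assms by (auto simp: factorizations_over_def)
  then have zero: "?c 0 = 0"
    by simp
  have "size_enumerator K l z n = (\<Sum>k<n. \<Sum>M\<in>{M \<in> ?R. size M = k}. z ^ size M)"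
    unfolding size_enumerator_def
    by (rule sum.group[symmetric]) (auto simp: finite_factorizations_over size_factorization_less)
  also have "\<dots> = (\<Sum>k<n. ?c k)"
    by (intro sum.cong) auto
  finally have "?c sums size_enumerator K l z n"
    using sums_finite[of "{..<n}" ?c] none by (force simp: not_less)
  then have "?c sums (size_enumerator K l z n + ?c 0)"
    by (simp only: zero add_0_right)
  then have "(\<lambda>k. ?c (Suc k)) sums size_enumerator K l z n"
    by (rule iffD2[OF sums_Suc_iff])
  then show ?thesis
    by (simp only: Suc_eq_plus1)
qed

text \<open>
  The partial products over the values \<open>2, \<dots>, N + 2\<close> run through boxes that exhaust all coloured parts;
  each value occurs with all its \<open>l\<close> colours, which is the source of the exponent \<open>l\<close>.
\<close>

lemma filterlim_colored_parts:
  "filterlim (\<lambda>N. {2..N + 2} \<times> {1..l}) (finite_subsets_at_top (colored_parts l)) sequentially"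
  unfolding filterlim_finite_subsets_at_top
proof safe
  fix X assume X: "finite X" "X \<subseteq> colored_parts l"
  obtain m where m: "fst ` X \<subseteq> {..m}"
    using X(1) finite_nat_iff_bounded_le[of "fst ` X"] by auto
  have "X \<subseteq> {2..N + 2} \<times> {1..l}" if "N \<ge> m" for N
  proof
    fix p assume "p \<in> X"
    then have "fst p \<le> m" "p \<in> colored_parts l"
      using m X(2) by auto
    then show "p \<in> {2..N + 2} \<times> {1..l}"
      using that by (auto simp: colored_parts_def)
  qed
  then show "\<forall>\<^sub>F N in sequentially. finite ({2..N + 2} \<times> {1..l}) \<and>
      X \<subseteq> {2..N + 2} \<times> {1..l} \<and> {2..N + 2} \<times> {1..l} \<subseteq> colored_parts l"
    unfolding eventually_sequentially by (intro exI[of _ m]) (auto simp: colored_parts_def)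
qed

lemma summable_on_colored_parts:
  fixes g :: "nat \<Rightarrow> real"
  assumes "summable g" "\<And>d. g d \<ge> 0"
  shows "(\<lambda>p. g (fst p)) summable_on colored_parts l"
  unfolding colored_parts_def
proof (rule summable_on_SigmaI[where g = "\<lambda>d. real l * g d"])
  show "((\<lambda>c. g (fst (d, c))) has_sum real l * g d) {1..l}" for d
    by (rule has_sum_finiteI) auto
  have "g summable_on UNIV"
    using assms by (simp add: summable_on_UNIV_nonneg_real_iff)
  then have "g summable_on {2..}"
    by (rule summable_on_subset_banach) simp
  then show "(\<lambda>d. real l * g d) summable_on {2..}"
    by (rule summable_on_cmult_right)
qed (use assms in auto)

text \<open>
  The sum of the weights of all factorizations, evaluated in two ways: as an Euler product over the
  coloured parts, and as a Dirichlet series by collecting the factorizations of each \<open>n \<ge> 1\<close>. The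
  empty factorization, the only one of \<open>1\<close>, contributes the leading term \<open>1\<close>. The constant \<open>c\<close>
  reduces the convergence of everything to that of \<open>\<Sum> d powr (- Re s)\<close>.
\<close>

theorem dirichlet_euler_product:
  fixes s z :: complex
  defines "y \<equiv> \<lambda>d::nat. z * of_nat d powr (- s)"
  assumes K: "0 \<in> K" and s: "Re s > 1" and c: "c \<ge> 0"
    and y: "\<And>d. d \<ge> 2 \<Longrightarrow> (\<lambda>k. norm (y d ^ k)) summable_on K"
      "\<And>d. d \<ge> 2 \<Longrightarrow> (\<Sum>\<^sub>\<infinity>k\<in>K. norm (y d ^ k)) \<le> 1 + c * norm (y d)"
  shows "summable (\<lambda>n. size_enumerator K l z (n + 2) * of_nat (n + 2) powr (- s))"
    and "(\<lambda>N. \<Prod>i\<le>N. (\<Sum>\<^sub>\<infinity>k\<in>K. y (i + 2) ^ k) ^ l) \<longlonglongrightarrow>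
      1 + (\<Sum>n. size_enumerator K l z (n + 2) * of_nat (n + 2) powr (- s))"
proof -
  let ?P = "colored_parts l"
  let ?M = "multisets_over K ?P"
  let ?R = "factorizations_over K l"
  define w :: "(nat \<times> nat) multiset \<Rightarrow> complex" where "w = (\<lambda>M. \<Prod>p\<in>#M. y (fst p))"
  define a where "a = (\<lambda>n. size_enumerator K l z n * of_nat n powr (- s))"
  have "summable (\<lambda>d. c * norm (y d))"
    using summable_norm_of_nat_powr[OF s] by (auto simp: y_def norm_mult intro!: summable_mult)
  then have b: "(\<lambda>p. c * norm (y (fst p))) summable_on ?P"
    by (rule summable_on_colored_parts) (use c in auto)
  have part: "fst p \<ge> 2" if "p \<in> ?P" for p
    using that by (auto simp: colored_parts_def)
  have w_sum: "(w has_sum infsum w ?M) ?M"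
    unfolding w_def
    by (rule has_sum_infsum, rule abs_summable_summable, rule multisets_over_abs_summable[OF K b])
      (use c y part in auto)
  have lim: "((\<lambda>F. \<Prod>p\<in>F. \<Sum>\<^sub>\<infinity>k\<in>K. y (fst p) ^ k) \<longlongrightarrow> infsum w ?M) (finite_subsets_at_top ?P)"
    unfolding w_def
    by (rule multisets_over_euler_product[OF K b]) (use c y part in auto)
  have "(\<Prod>p\<in>{2..N + 2} \<times> {1..l}. \<Sum>\<^sub>\<infinity>k\<in>K. y (fst p) ^ k) = (\<Prod>i\<le>N. (\<Sum>\<^sub>\<infinity>k\<in>K. y (i + 2) ^ k) ^ l)"
    for N
  proof -
    have "(\<Prod>p\<in>{2..N + 2} \<times> {1..l}. \<Sum>\<^sub>\<infinity>k\<in>K. y (fst p) ^ k)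
        = (\<Prod>(d, c)\<in>{0 + 2..N + 2} \<times> {1..l}. \<Sum>\<^sub>\<infinity>k\<in>K. y d ^ k)"
      by (simp only: case_prod_unfold add_0)
    also have "\<dots> = (\<Prod>d\<in>{0 + 2..N + 2}. \<Prod>c\<in>{1..l}. \<Sum>\<^sub>\<infinity>k\<in>K. y d ^ k)"
      by (rule prod.cartesian_product[symmetric])
    also have "\<dots> = (\<Prod>i\<le>N. (\<Sum>\<^sub>\<infinity>k\<in>K. y (i + 2) ^ k) ^ l)"
      unfolding prod.shift_bounds_cl_nat_ivl by (simp add: atMost_atLeast0)
    finally show ?thesis .
  qed
  then have partial: "(\<lambda>N. \<Prod>i\<le>N. (\<Sum>\<^sub>\<infinity>k\<in>K. y (i + 2) ^ k) ^ l) \<longlonglongrightarrow> infsum w ?M"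
    using filterlim_compose[OF lim filterlim_colored_parts] by simp

  have bij: "bij_betw snd (SIGMA n:{1..}. ?R n) ?M"
  proof (rule bij_betw_byWitness[where f' = "\<lambda>M. (\<Prod>p\<in>#M. fst p, M)"])
    show "(\<lambda>M. (\<Prod>p\<in>#M. fst p, M)) ` ?M \<subseteq> (SIGMA n:{1..}. ?R n)"
    proof (rule image_subsetI)
      fix M assume M: "M \<in> ?M"
      then have "set_mset M \<subseteq> ?P"
        by (simp add: multisets_over_def)
      then have "1 \<le> (\<Prod>p\<in>#M. fst p)"
        using size_less_prod_parts[of M l] by linarith
      then show "(\<Prod>p\<in>#M. fst p, M) \<in> (SIGMA n:{1..}. ?R n)"
        using M by (simp add: factorizations_over_def)
    qed
    show "snd ` (SIGMA n:{1..}. ?R n) \<subseteq> ?M"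
      by (auto simp: factorizations_over_def)
  qed (simp_all add: factorizations_over_def)
  have "(a has_sum infsum w ?M) {1..}"
  proof (rule has_sum_SigmaD)
    show "((\<lambda>q. w (snd q)) has_sum infsum w ?M) (SIGMA n:{1..}. ?R n)"
      using w_sum unfolding has_sum_reindex_bij_betw[OF bij] .
    fix n :: nat
    have "a n = (\<Sum>M\<in>?R n. w M)"
      unfolding a_def size_enumerator_def sum_distrib_right
      by (rule sum.cong) (auto simp: w_def y_def prod_weight_parts factorizations_over_def)
    then show "((\<lambda>M. w (snd (n, M))) has_sum a n) (?R n)"
      by (intro has_sum_finiteI) (auto simp: finite_factorizations_over)
  qed
  then have tail: "(a has_sum (infsum w ?M - a 1)) ({1..} - {1})"
    by (rule has_sum_Diff[OF _ has_sum_finiteI[of "{1}"]]) auto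
  have a_1: "a 1 = 1"
    using factorizations_over_1[OF K, of l] by (simp add: a_def size_enumerator_def)
  have shift: "bij_betw (\<lambda>n. n + 2) UNIV ({1..} - {1::nat})"
    by (rule bij_betw_byWitness[where f' = "\<lambda>n. n - 2"]) auto
  have "((\<lambda>n. a (n + 2)) has_sum (infsum w ?M - 1)) UNIV"
    using tail unfolding has_sum_reindex_bij_betw[OF shift] a_1 .
  then have sums: "(\<lambda>n. a (n + 2)) sums (infsum w ?M - 1)"
    by (rule has_sum_imp_sums)
  then show "summable (\<lambda>n. size_enumerator K l z (n + 2) * of_nat (n + 2) powr (- s))"
    unfolding a_def by (rule sums_summable)
  have "infsum w ?M = 1 + (\<Sum>n. size_enumerator K l z (n + 2) * of_nat (n + 2) powr (- s))"
    using sums_unique[OF sums] unfolding a_def diff_eq_eq by (simp only: add.commute)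
  then show "(\<lambda>N. \<Prod>i\<le>N. (\<Sum>\<^sub>\<infinity>k\<in>K. y (i + 2) ^ k) ^ l) \<longlonglongrightarrow>
      1 + (\<Sum>n. size_enumerator K l z (n + 2) * of_nat (n + 2) powr (- s))"
    using partial by simp
qed

text \<open>
  The convention for infinite products requires the partial products to tend to a nonzero limit once
  finitely many zero factors are removed; knowing the limit of the partial products is therefore not
  enough. A factor does vanish if \<open>z = - (d powr s)\<close> for some \<open>d\<close>, and absolute convergence covers this case.
\<close>

lemma convergent_prod_parts:
  fixes s z :: complex
  assumes "Re s > 1"
  shows "convergent_prod (\<lambda>n. 1 + z * of_nat (n + 2) powr (- s))"
proof (intro abs_convergent_prod_imp_convergent_prod summable_imp_abs_convergent_prod)
  have "summable (\<lambda>n. norm (of_nat (n + 2) powr (- s) :: complex))"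
    by (rule summable_ignore_initial_segment[OF summable_norm_of_nat_powr[OF assms]])
  then show "summable (\<lambda>n. norm (1 + z * of_nat (n + 2) powr (- s) - 1))"
    by (simp add: norm_mult summable_mult)
qed

lemma has_prod_if_LIMSEQ:
  fixes f :: "nat \<Rightarrow> complex"
  assumes "convergent_prod f" "(\<lambda>n. \<Prod>i\<le>n. f i) \<longlonglongrightarrow> S"
  shows "f has_prod S"
  using convergent_prod_has_prod[OF assms(1)]
    LIMSEQ_unique[OF convergent_prod_LIMSEQ[OF assms(1)] assms(2)] by simp

text \<open>
  With all multiplicities allowed, the factor of a part is a geometric series. The hypothesis on \<open>z\<close>
  says that its ratio has norm less than 1 at the value 2. This is the largest ratio, so the
  denominators \<open>1 - norm (y d)\<close> stay away from 0 uniformly in \<open>d\<close>.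
\<close>

lemma unrestricted_euler_product:
  fixes s z :: complex
  assumes s: "Re s > 1" and z: "norm z < 2 powr Re s"
  shows "summable (\<lambda>n. size_enumerator UNIV l z (n + 2) * of_nat (n + 2) powr (- s))"
    and "(\<lambda>n. (1 - z * of_nat (n + 2) powr (- s)) powi (- int l)) has_prod
      (1 + (\<Sum>n. size_enumerator UNIV l z (n + 2) * of_nat (n + 2) powr (- s)))"
proof -
  define y where "y = (\<lambda>d::nat. z * of_nat d powr (- s))"
  define q where "q = norm z * 2 powr (- Re s)"
  have q: "0 \<le> q" "q < 1"
    using z by (auto simp: q_def powr_minus field_simps)
  have y_le: "norm (y d) \<le> q" if "d \<ge> 2" for d
    unfolding y_def q_def norm_mult norm_of_nat_powr
    using that s by (intro mult_left_mono powr_mono2') auto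
  have geometric: "((\<lambda>k. u ^ k) has_sum inverse (1 - u)) UNIV" if "norm u < 1"
    for u :: "'a::{real_normed_field,banach}"
    using norm_summable_imp_has_sum[OF _ geometric_sums[OF that]] that
    by (simp add: norm_power divide_inverse)
  have norm_sum: "((\<lambda>k. norm (y d ^ k)) has_sum inverse (1 - norm (y d))) UNIV" if "d \<ge> 2" for d
    unfolding norm_power by (rule geometric) (use y_le[OF that] q in auto)
  have bound: "(\<Sum>\<^sub>\<infinity>k. norm (y d ^ k)) \<le> 1 + inverse (1 - q) * norm (y d)" if "d \<ge> 2" for d
  proof -
    have "norm (y d) < 1"
      using y_le[OF that] q by simp
    then have "inverse (1 - norm (y d)) = 1 + inverse (1 - norm (y d)) * norm (y d)"
      by (simp add: field_simps)
    also have "\<dots> \<le> 1 + inverse (1 - q) * norm (y d)"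
      using y_le[OF that] q by (intro add_left_mono mult_right_mono le_imp_inverse_le) auto
    finally show ?thesis
      using infsumI[OF norm_sum[OF that]] by simp
  qed
  have summ: "(\<lambda>k. norm (y d ^ k)) summable_on UNIV" if "d \<ge> 2" for d
    using norm_sum[OF that] by (rule has_sum_imp_summable)
  note euler = dirichlet_euler_product[OF UNIV_I s _ summ[unfolded y_def] bound[unfolded y_def], of l]
  show "summable (\<lambda>n. size_enumerator UNIV l z (n + 2) * of_nat (n + 2) powr (- s))"
    by (rule euler(1)) (use q in auto)
  have factor: "(\<Sum>\<^sub>\<infinity>k. y (n + 2) ^ k) ^ l = (1 - y (n + 2)) powi (- int l)" for n
  proof -
    have "(\<Sum>\<^sub>\<infinity>k. y (n + 2) ^ k) = inverse (1 - y (n + 2))"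
      by (intro infsumI geometric) (use y_le[of "n + 2"] q in auto)
    then show ?thesis
      by (simp add: power_int_minus power_inverse)
  qed
  have "convergent_prod (\<lambda>n. 1 - y (n + 2))"
    using convergent_prod_parts[OF s, of "- z"] by (simp add: y_def)
  then have "convergent_prod (\<lambda>n. (1 - y (n + 2)) powi (- int l))"
    by (simp add: power_int_minus convergent_prod_power)
  moreover have "(\<lambda>N. \<Prod>i\<le>N. (1 - y (i + 2)) powi (- int l)) \<longlonglongrightarrow>
      1 + (\<Sum>n. size_enumerator UNIV l z (n + 2) * of_nat (n + 2) powr (- s))"
    unfolding factor[symmetric] unfolding y_def by (rule euler(2)) (use q in auto)
  ultimately show "(\<lambda>n. (1 - z * of_nat (n + 2) powr (- s)) powi (- int l)) has_prod
      (1 + (\<Sum>n. size_enumerator UNIV l z (n + 2) * of_nat (n + 2) powr (- s)))"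
    unfolding y_def by (rule has_prod_if_LIMSEQ)
qed

text \<open>
  With multiplicities 0 and 1, the factor of a part is \<open>1 + z * d powr (- s)\<close>, whatever the size of
  \<open>z\<close>.
\<close>

lemma distinct_euler_product:
  fixes s z :: complex
  assumes s: "Re s > 1"
  shows "summable (\<lambda>n. size_enumerator {0, 1} l z (n + 2) * of_nat (n + 2) powr (- s))"
    and "(\<lambda>n. (1 + z * of_nat (n + 2) powr (- s)) ^ l) has_prod
      (1 + (\<Sum>n. size_enumerator {0, 1} l z (n + 2) * of_nat (n + 2) powr (- s)))"
proof -
  have norms: "(\<lambda>k. norm ((z * of_nat d powr (- s)) ^ k)) summable_on {0, 1::nat}"
    "(\<Sum>\<^sub>\<infinity>k\<in>{0, 1::nat}. norm ((z * of_nat d powr (- s)) ^ k)) \<le> 1 + 1 * norm (z * of_nat d powr (- s))"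
    for d :: nat
    by auto
  note euler = dirichlet_euler_product[OF insertI1 s zero_le_one norms, of l]
  show "summable (\<lambda>n. size_enumerator {0, 1} l z (n + 2) * of_nat (n + 2) powr (- s))"
    by (rule euler(1))
  have "(\<Sum>\<^sub>\<infinity>k\<in>{0, 1::nat}. u ^ k) = 1 + u" for u :: complex
    by simp
  then have "(\<lambda>N. \<Prod>i\<le>N. (1 + z * of_nat (i + 2) powr (- s)) ^ l) \<longlonglongrightarrow>
      1 + (\<Sum>n. size_enumerator {0, 1} l z (n + 2) * of_nat (n + 2) powr (- s))"
    using euler(2) by simp
  then show "(\<lambda>n. (1 + z * of_nat (n + 2) powr (- s)) ^ l) has_prod
      (1 + (\<Sum>n. size_enumerator {0, 1} l z (n + 2) * of_nat (n + 2) powr (- s)))"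
    by (intro has_prod_if_LIMSEQ convergent_prod_power convergent_prod_parts s)
qed

section \<open>The four generating functions\<close>

lemma A_term_eq: "A_term l s n = size_enumerator UNIV l 1 n * of_nat n powr (- s)"
  by (simp add: A_term_def A_def factorizations_eq size_enumerator_def)

lemma B_term_eq: "B_term l s n = size_enumerator {0, 1} l 1 n * of_nat n powr (- s)"
  by (simp add: B_term_def B_def distinct_factorizations_eq size_enumerator_def)

lemma F_term_sums:
  assumes "n \<ge> 2"
  shows "(\<lambda>k. F_term l s z n (k + 1)) sums (size_enumerator UNIV l z n * of_nat n powr (- s))"
  using sums_mult2[OF size_enumerator_sums[OF assms, of UNIV l z], of "of_nat n powr (- s)"]
  by (simp add: F_term_def f_parts_def factorizations_eq mult_ac)

lemma G_term_sums:
  assumes "n \<ge> 2"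
  shows "(\<lambda>k. G_term l s z n (k + 1)) sums (size_enumerator {0, 1} l z n * of_nat n powr (- s))"
  using sums_mult2[OF size_enumerator_sums[OF assms, of "{0, 1}" l z], of "of_nat n powr (- s)"]
  by (simp add: G_term_def g_parts_def distinct_factorizations_eq mult_ac)

theorem lemma1:
  fixes l :: nat
  assumes "l \<ge> 1"
  shows "(\<forall>n\<ge>1. A l n = conv_power (A 1) l n) \<and>
    (\<forall>n\<ge>1. B l n = conv_power (B 1) l n) \<and>
    (\<forall>s::complex. Re s > 1 \<longrightarrow>
      summable (\<lambda>n. A_term l s (n + 2)) \<and>
      (\<lambda>n. (1 - of_nat (n + 2) powr (- s)) powi (- int l)) has_prod A_series l s \<and>
      summable (\<lambda>n. B_term l s (n + 2)) \<and>
      (\<lambda>n. (1 + of_nat (n + 2) powr (- s)) ^ l) has_prod B_series l s) \<and>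
    (\<forall>s z::complex. Re s > 1 \<and> Re z > 1 \<and> norm z < 2 powr Re s \<longrightarrow>
      (\<forall>n. summable (\<lambda>k. F_term l s z (n + 2) (k + 1))) \<and>
      summable (\<lambda>n. \<Sum>k. F_term l s z (n + 2) (k + 1)) \<and>
      (\<lambda>n. (1 - z * of_nat (n + 2) powr (- s)) powi (- int l)) has_prod F_series l s z) \<and>
    (\<forall>s z::complex. Re s > 1 \<and> Re z > 1 \<longrightarrow>
      (\<forall>n. summable (\<lambda>k. G_term l s z (n + 2) (k + 1))) \<and>
      summable (\<lambda>n. \<Sum>k. G_term l s z (n + 2) (k + 1)) \<and>
      (\<lambda>n. (1 + z * of_nat (n + 2) powr (- s)) ^ l) has_prod G_series l s z)"
proof (intro conjI allI impI)
  fix n :: nat assume n: "n \<ge> 1"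
  show "A l n = conv_power (A 1) l n"
    using card_factorizations_over_conv_power[OF UNIV_I assms n]
    by (simp add: A_def[abs_def] factorizations_eq)
  show "B l n = conv_power (B 1) l n"
    using card_factorizations_over_conv_power[OF insertI1 assms n, of "{1}"]
    by (simp add: B_def[abs_def] distinct_factorizations_eq)
next
  fix s :: complex assume s: "Re s > 1"
  have one: "norm (1 :: complex) < 2 powr Re s"
    using s by simp
  show "summable (\<lambda>n. A_term l s (n + 2))"
    unfolding A_term_eq by (rule unrestricted_euler_product(1)[OF s one])
  show "(\<lambda>n. (1 - of_nat (n + 2) powr (- s)) powi (- int l)) has_prod A_series l s"
    using unrestricted_euler_product(2)[OF s one] unfolding A_series_def A_term_eq mult_1 .
  show "summable (\<lambda>n. B_term l s (n + 2))"
    unfolding B_term_eq by (rule distinct_euler_product(1)[OF s])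
  show "(\<lambda>n. (1 + of_nat (n + 2) powr (- s)) ^ l) has_prod B_series l s"
    using distinct_euler_product(2)[OF s, of 1] unfolding B_series_def B_term_eq mult_1 .
next
  fix s z :: complex and n :: nat
  have F: "(\<lambda>k. F_term l s z (n + 2) (k + 1)) sums
      (size_enumerator UNIV l z (n + 2) * of_nat (n + 2) powr (- s))" for n
    by (rule F_term_sums) simp
  show "summable (\<lambda>k. F_term l s z (n + 2) (k + 1))"
    by (rule sums_summable[OF F])
  assume sz: "Re s > 1 \<and> Re z > 1 \<and> norm z < 2 powr Re s"
  then show "summable (\<lambda>n. \<Sum>k. F_term l s z (n + 2) (k + 1))"
    unfolding sums_unique[OF F, symmetric] by (intro unrestricted_euler_product(1)) auto
  show "(\<lambda>n. (1 - z * of_nat (n + 2) powr (- s)) powi (- int l)) has_prod F_series l s z"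
    unfolding F_series_def sums_unique[OF F, symmetric]
    using sz by (intro unrestricted_euler_product(2)) auto
next
  fix s z :: complex and n :: nat
  have G: "(\<lambda>k. G_term l s z (n + 2) (k + 1)) sums
      (size_enumerator {0, 1} l z (n + 2) * of_nat (n + 2) powr (- s))" for n
    by (rule G_term_sums) simp
  show "summable (\<lambda>k. G_term l s z (n + 2) (k + 1))"
    by (rule sums_summable[OF G])
  assume sz: "Re s > 1 \<and> Re z > 1"
  then show "summable (\<lambda>n. \<Sum>k. G_term l s z (n + 2) (k + 1))"
    unfolding sums_unique[OF G, symmetric] by (intro distinct_euler_product(1)) auto
  show "(\<lambda>n. (1 + z * of_nat (n + 2) powr (- s)) ^ l) has_prod G_series l s z"
    unfolding G_series_def sums_unique[OF G, symmetric]
    using sz by (intro distinct_euler_product(2)) auto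
qed

end
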